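(* Let $\Theta\subset\mathbb{R}$ and let $\mathcal{P}=\{P_\theta\}_{\theta\in\Theta}$ be $L^1$-differentiable at $\theta_0$ with score $\dot\ell_{\theta_0}$ and $J_{\theta_0}=\mathbb{E}_{\theta_0}[|\dot\ell_{\theta_0}|]>0$. Assume that $\theta_0$ is identifiable: for every $\delta>0$ there exists $\gamma>0$ such that $|\theta-\theta_0|>\delta$ implies $d_{\mathrm{hel}}^2(P_\theta,P_{\theta_0})>\gamma$. Let $\psi:\Theta\to\mathbb{R}$ be $\mathcal{C}^1$ near $\theta_0$. Let $L:\mathbb{R}\to\mathbb{R}_+$ be symmetric and quasiconvex with $L(0)=0$, and assume there exist a numerical constant $C_L<\infty$ and $\beta\in\mathbb{R}_+$ such that $L(at)\le C_La^\beta L(t)$ for all $a\ge1$ and all $t$. Let $0<\varepsilon\le2$ and let $\mathcal{Q}_\varepsilon$ be the collection of $\varepsilon$-locally differentially private non-interactive channels. Then there exist a numerical constant $C<\infty$ and a $\delta_0=\delta_0(\psi,\theta_0,\mathcal{P})>0$ depending only on $\psi$, $\theta_0$ and the family $\mathcal{P}$ such that $$\mathfrak{M}^{\mathrm{loc}}_n(P_{\theta_0},L,\mathcal{P},\mathcal{Q}_\varepsilon)\ \le\ C\max\left\{\Big(\frac{\beta}{2e}\Big)^{\beta/2}L\!\left(\frac{\psi'(\theta_0)}{J_{\theta_0}}\frac{1}{\sqrt{n\varepsilon^2}}\right),\ L(\operatorname{diam}(\psi(\Theta)))\,e^{-\delta_0^2n\varepsilon^2}\right\}.$$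
   Context: $L^1$-differentiability at $\theta_0$: with densities $p_\theta=dP_\theta/d\mu$ with respect to a dominating measure $\mu$, $\int|p_{\theta_0+h}-p_{\theta_0}-h\dot\ell_{\theta_0}p_{\theta_0}|\,d\mu=o(|h|)$ as $h\to0$. $d_{\mathrm{hel}}^2(P_0,P_1)=\frac12\int(\sqrt{dP_0}-\sqrt{dP_1})^2$. A non-interactive channel is a Markov kernel $Q(\cdot\mid x)$ with $Z_i\mid X_i=x\sim Q(\cdot\mid x)$; it is $\varepsilon$-locally differentially private if $Q(A\mid x)\le e^\varepsilon Q(A\mid x')$ for all $x,x'$ and measurable $A$. The local minimax risk for estimating $\psi(\theta)$ is $$\mathfrak{M}^{\mathrm{loc}}_n(P_{\theta_0},L,\mathcal{P},\mathcal{Q})=\sup_{\theta_1\in\Theta}\ \inf_{\hat\psi,\,Q\in\mathcal{Q}}\ \max_{\theta\in\{\theta_0,\theta_1\}}\mathbb{E}_{Q\circ P_\theta}\big[L(\hat\psi(Z_1,\dots,Z_n)-\psi(\theta))\big],$$ where $Q\circ P$ is the law of $Z_{1:n}$ when $X_i\overset{iid}\sim P$, and the infimum is over all estimators $\hat\psi$ of $Z_{1:n}$. "Numerical constant" means a universal constant.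
   Formalization: The claim fails as stated: ψ'(θ_0) ≠ 0 is added (else ψ(t)=t² at 0 is a counterexample), and a factor B^β, B universal, multiplies the first term (C must grow like 2^β for L=|t|^β). C may depend on C_L; C, B are stated per sample-space type; L(∞) = sup L. *)

theory Defs
  imports "HOL-Probability.Probability" "HOL-Library.Landau_Symbols"
begin

text \<open>A family of distributions indexed by \<open>\<Theta>\<close> is given by the densities \<open>p \<theta>\<close> with respect to
  a common dominating measure \<open>\<mu>\<close>.\<close>

definition distr_of :: "'a measure \<Rightarrow> (real \<Rightarrow> 'a \<Rightarrow> real) \<Rightarrow> real \<Rightarrow> 'a measure" where
  "distr_of \<mu> p \<theta> = density \<mu> (\<lambda>x. ennreal (p \<theta> x))"

definition dominated_family :: "'a measure \<Rightarrow> real set \<Rightarrow> (real \<Rightarrow> 'a \<Rightarrow> real) \<Rightarrow> bool" where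
  "dominated_family \<mu> \<Theta> p \<longleftrightarrow>
     (\<forall>\<theta>\<in>\<Theta>. p \<theta> \<in> borel_measurable \<mu> \<and> (\<forall>x\<in>space \<mu>. 0 \<le> p \<theta> x) \<and> prob_space (distr_of \<mu> p \<theta>))"

text \<open>The limit \<open>h \<rightarrow> 0\<close> runs over those \<open>h\<close> with \<open>\<theta>0 + h \<in> \<Theta>\<close>; \<open>\<theta>0\<close> may be a boundary point.
  Integrability of the score under \<open>P\<^bsub>\<theta>0\<^esub>\<close> is required explicitly because the Bochner
  integral of a non-integrable function is 0; the remainder is then integrable as well.\<close>

definition L1_differentiable_at ::
    "'a measure \<Rightarrow> real set \<Rightarrow> (real \<Rightarrow> 'a \<Rightarrow> real) \<Rightarrow> real \<Rightarrow> ('a \<Rightarrow> real) \<Rightarrow> bool" where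
  "L1_differentiable_at \<mu> \<Theta> p \<theta>0 score \<longleftrightarrow>
     score \<in> borel_measurable \<mu> \<and> integrable (distr_of \<mu> p \<theta>0) score \<and>
     (\<lambda>h. \<integral>x. \<bar>p (\<theta>0 + h) x - p \<theta>0 x - h * score x * p \<theta>0 x\<bar> \<partial>\<mu>)
       \<in> o[at 0 within {h. \<theta>0 + h \<in> \<Theta>}](\<lambda>h. \<bar>h\<bar>)"

definition L1_information :: "'a measure \<Rightarrow> (real \<Rightarrow> 'a \<Rightarrow> real) \<Rightarrow> real \<Rightarrow> ('a \<Rightarrow> real) \<Rightarrow> real" where
  "L1_information \<mu> p \<theta>0 score = (\<integral>x. \<bar>score x\<bar> \<partial>(distr_of \<mu> p \<theta>0))"

definition hellinger_sq :: "'a measure \<Rightarrow> ('a \<Rightarrow> real) \<Rightarrow> ('a \<Rightarrow> real) \<Rightarrow> real" where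
  "hellinger_sq \<mu> f g = 1 / 2 * (\<integral>x. (sqrt (f x) - sqrt (g x))\<^sup>2 \<partial>\<mu>)"

definition identifiable_at :: "'a measure \<Rightarrow> real set \<Rightarrow> (real \<Rightarrow> 'a \<Rightarrow> real) \<Rightarrow> real \<Rightarrow> bool" where
  "identifiable_at \<mu> \<Theta> p \<theta>0 \<longleftrightarrow>
     (\<forall>\<delta>>0. \<exists>\<gamma>>0. \<forall>\<theta>\<in>\<Theta>. \<bar>\<theta> - \<theta>0\<bar> > \<delta> \<longrightarrow> hellinger_sq \<mu> (p \<theta>) (p \<theta>0) > \<gamma>)"

definition C1_near :: "real set \<Rightarrow> real \<Rightarrow> (real \<Rightarrow> real) \<Rightarrow> (real \<Rightarrow> real) \<Rightarrow> bool" where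
  "C1_near \<Theta> \<theta>0 \<psi> \<psi>' \<longleftrightarrow>
     (\<exists>r>0. (\<forall>\<theta>\<in>\<Theta> \<inter> ball \<theta>0 r. (\<psi> has_real_derivative \<psi>' \<theta>) (at \<theta> within \<Theta>)) \<and>
            continuous_on (\<Theta> \<inter> ball \<theta>0 r) \<psi>')"

definition quasiconvex :: "(real \<Rightarrow> real) \<Rightarrow> bool" where
  "quasiconvex L \<longleftrightarrow> (\<forall>c. convex {t. L t \<le> c})"

definition symmetric_loss :: "(real \<Rightarrow> real) \<Rightarrow> bool" where
  "symmetric_loss L \<longleftrightarrow> (\<forall>t. 0 \<le> L t) \<and> (\<forall>t. L (- t) = L t) \<and> quasiconvex L \<and> L 0 = 0"

definition poly_growth :: "real \<Rightarrow> real \<Rightarrow> (real \<Rightarrow> real) \<Rightarrow> bool" where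
  "poly_growth K \<beta> L \<longleftrightarrow> (\<forall>a\<ge>1. \<forall>t. L (a * t) \<le> K * a powr \<beta> * L t)"

text \<open>\<open>L (diam S)\<close>, where for unbounded \<open>S\<close> the value \<open>L \<infinity>\<close> is the limit of the
  nondecreasing function \<open>L\<close> on the half-line, i.e. its supremum.\<close>

definition loss_diam :: "(real \<Rightarrow> real) \<Rightarrow> real set \<Rightarrow> ennreal" where
  "loss_diam L S = (if bounded S then ennreal (L (diameter S)) else (SUP t. ennreal (L t)))"

text \<open>Markov kernels from \<open>X\<close> to \<open>Z\<close> that are \<open>\<epsilon>\<close>-locally differentially private. The same kernel
  is applied to each observation.\<close>

definition ldp_channels :: "'a measure \<Rightarrow> 'z measure \<Rightarrow> real \<Rightarrow> ('a \<Rightarrow> 'z measure) set" where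
  "ldp_channels X Z \<epsilon> = {Q. Q \<in> X \<rightarrow>\<^sub>M prob_algebra Z \<and>
     (\<forall>x\<in>space X. \<forall>x'\<in>space X. \<forall>A\<in>sets Z. measure (Q x) A \<le> exp \<epsilon> * measure (Q x') A)}"

text \<open>The law of \<open>Z\<^sub>1, \<dots>, Z\<^sub>n\<close>: the \<open>n\<close>-fold product of the marginal law
  \<open>A \<mapsto> \<integral> Q(A | x) dP(x)\<close>.\<close>

definition private_law :: "nat \<Rightarrow> ('a \<Rightarrow> 'z measure) \<Rightarrow> 'a measure \<Rightarrow> (nat \<Rightarrow> 'z) measure" where
  "private_law n Q P = PiM {..<n} (\<lambda>_. P \<bind> Q)"

definition private_risk ::
    "nat \<Rightarrow> (real \<Rightarrow> real) \<Rightarrow> ('a \<Rightarrow> 'z measure) \<Rightarrow> 'a measure \<Rightarrow> ((nat \<Rightarrow> 'z) \<Rightarrow> real) \<Rightarrow> real \<Rightarrow> ennreal" where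
  "private_risk n L Q P est v = (\<integral>\<^sup>+z. ennreal (L (est z - v)) \<partial>private_law n Q P)"

definition local_minimax_risk ::
    "nat \<Rightarrow> real set \<Rightarrow> (real \<Rightarrow> 'a measure) \<Rightarrow> real \<Rightarrow> (real \<Rightarrow> real) \<Rightarrow> (real \<Rightarrow> real) \<Rightarrow>
     'z measure \<Rightarrow> ('a \<Rightarrow> 'z measure) set \<Rightarrow> ennreal" where
  "local_minimax_risk n \<Theta> P \<theta>0 \<psi> L Z \<Q> =
     (SUP \<theta>1\<in>\<Theta>. INF (est, Q) \<in> (PiM {..<n} (\<lambda>_. Z) \<rightarrow>\<^sub>M borel) \<times> \<Q>.
        MAX \<theta>\<in>{\<theta>0, \<theta>1}. private_risk n L Q (P \<theta>) est (\<psi> \<theta>))"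

text \<open>The risk over all \<open>\<epsilon>\<close>-locally private channels. Taking the output space to be the Borel reals
  loses nothing: an estimator based on outputs in any measurable space is measurable with respect to
  the \<open>n\<close>-fold product of a countably generated sub-\<open>\<sigma>\<close>-algebra, so it factors through a measurable
  map of each output into the reals, and post-composing a channel with such a map preserves
  \<open>\<epsilon>\<close>-local privacy.\<close>

definition ldp_local_minimax_risk ::
    "nat \<Rightarrow> 'a measure \<Rightarrow> real set \<Rightarrow> (real \<Rightarrow> 'a measure) \<Rightarrow> real \<Rightarrow> (real \<Rightarrow> real) \<Rightarrow> (real \<Rightarrow> real) \<Rightarrow>
     real \<Rightarrow> ennreal" where
  "ldp_local_minimax_risk n X \<Theta> P \<theta>0 \<psi> L \<epsilon> =
     local_minimax_risk n \<Theta> P \<theta>0 \<psi> L (borel :: real measure) (ldp_channels X borel \<epsilon>)"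

text \<open>\<open>(\<beta> / 2e)\<close> to the power \<open>\<beta> / 2\<close>, with \<open>0\<close> to the power \<open>0\<close> equal to 1 (whereas \<open>0 powr 0 = 0\<close>).\<close>

definition beta_factor :: "real \<Rightarrow> real" where
  "beta_factor \<beta> = (if \<beta> = 0 then 1 else (\<beta> / (2 * exp 1)) powr (\<beta> / 2))"

end

theory Submission
  imports Defs
begin

text \<open>The bound comes from one explicit procedure for testing \<open>\<theta>0\<close> against a given alternative \<open>\<theta>1\<close>.
  Each observation is reduced to the bit \<open>p \<theta>1 x > p \<theta>0 x\<close>, whose probabilities under the two laws
  differ by exactly their total variation distance \<open>T\<close>, and this bit is released by randomized
  response. For \<open>\<epsilon> \<le> 2\<close> randomized response preserves at least the fraction \<open>\<epsilon> / 10\<close> of the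
  difference. Counting the released bits and answering \<open>\<psi> \<theta>0\<close> or \<open>\<psi> \<theta>1\<close> according to the midpoint
  threshold errs, by Hoeffding's inequality, with probability at most \<open>exp (- n \<epsilon>\<^sup>2 T\<^sup>2 / 200)\<close>,
  and an error costs \<open>L (\<psi> \<theta>1 - \<psi> \<theta>0)\<close>. This is \<open>ldp_two_point_bound\<close>; it remains to bound
  \<open>L (\<psi> \<theta>1 - \<psi> \<theta>0) * exp (- n \<epsilon>\<^sup>2 T\<^sup>2 / 200)\<close> uniformly in \<open>\<theta>1\<close>.

  Let \<open>h = \<bar>\<theta>1 - \<theta>0\<bar>\<close> and let \<open>J\<close> be the \<open>L\<^sup>1\<close> information. If \<open>h\<close> is small, \<open>L\<^sup>1\<close>-differentiability
  gives \<open>T \<ge> h J / 4\<close> (\<open>L1_distance_local_lower_bound\<close>), while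
  \<open>\<bar>\<psi> \<theta>1 - \<psi> \<theta>0\<bar> \<le> 2 \<bar>\<psi>' \<theta>0\<bar> h\<close>. In the dimensionless variable \<open>s = h J sqrt (n \<epsilon>\<^sup>2)\<close> the loss is
  then at most \<open>L (2 s t)\<close>, where \<open>t\<close> is the argument of \<open>L\<close> in the claim, and the error probability is at
  most \<open>exp (- s\<^sup>2 / 3200)\<close>. Polynomial growth bounds \<open>L (2 s t)\<close> by a multiple of \<open>(2 s)\<^sup>\<beta> L t\<close>, and maximizing
  \<open>(2 s)\<^sup>\<beta> exp (- s\<^sup>2 / 3200)\<close> over \<open>s\<close> produces \<open>(\<beta> / 2e)\<close> to the power \<open>\<beta> / 2\<close> together with the
  geometric factor \<open>B\<^sup>\<beta>\<close> (\<open>rescaled_loss_gaussian_bound\<close>). If \<open>h\<close> is not small, identifiability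
  keeps the Hellinger distance, and with it \<open>T\<close>, away from zero, while the loss is at most that of
  the diameter; this is the exponentially small term.\<close>

section \<open>Loss functions against Gaussian tails\<close>

text \<open>The sublevel sets of \<open>L\<close> are convex and symmetric, hence intervals centred at zero.\<close>

lemma symmetric_loss_mono:
  assumes "symmetric_loss L" "\<bar>s\<bar> \<le> \<bar>t\<bar>"
  shows "L s \<le> L t"
proof -
  have cvx: "convex {u. L u \<le> L t}" and sym: "L (- t) = L t"
    using assms(1) unfolding symmetric_loss_def quasiconvex_def by auto
  have abs: "L \<bar>t\<bar> = L t" "L (- \<bar>t\<bar>) = L t"
    using sym by (auto simp: abs_if)
  have "closed_segment (- \<bar>t\<bar>) \<bar>t\<bar> \<subseteq> {u. L u \<le> L t}"
    using abs by (intro closed_segment_subset cvx) auto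
  moreover have "s \<in> closed_segment (- \<bar>t\<bar>) \<bar>t\<bar>"
    using assms(2) by (auto simp: closed_segment_eq_real_ivl)
  ultimately show ?thesis by auto
qed

text \<open>With \<open>u = \<beta> / 2e\<close> the factor is \<open>exp (e u ln u)\<close>, and \<open>u ln u\<close> has its minimum \<open>- 1 / e\<close> at
  \<open>u = 1 / e\<close>. This lower bound lets a multiple of the factor dominate \<open>1\<close> when the loss needs no
  rescaling.\<close>

lemma exp_minus_one_le_beta_factor:
  assumes "0 \<le> \<beta>"
  shows "exp (- 1) \<le> beta_factor \<beta>"
proof (cases "\<beta> = 0")
  case True
  then show ?thesis by (simp add: beta_factor_def)
next
  case False
  define u where "u = \<beta> / (2 * exp 1)"
  have u: "u > 0" "\<beta> / 2 = u * exp 1" using False assms by (auto simp: u_def)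
  have "ln (1 / (u * exp 1)) \<le> 1 / (u * exp 1) - 1"
    using u by (intro ln_le_minus_one) auto
  then have "- ln u \<le> 1 / (u * exp 1)"
    using u by (simp add: ln_div ln_mult)
  then have "u * exp 1 * (- ln u) \<le> u * exp 1 * (1 / (u * exp 1))"
    using u by (intro mult_left_mono) auto
  then have "- 1 \<le> (\<beta> / 2) * ln u"
    using u by simp
  then show ?thesis
    using False u by (simp add: beta_factor_def u_def[symmetric] powr_def)
qed

text \<open>The maximum over \<open>s\<close> is attained at \<open>s\<^sup>2 = \<beta> / (2 k)\<close>. Relative to this point, \<open>w = 2 k s\<^sup>2 / \<beta>\<close>,
  the claim is \<open>ln w \<le> w - 1\<close>.\<close>

lemma powr_gaussian_le_beta_factor:
  assumes "0 \<le> \<beta>" "0 < k" "0 < s"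
  shows "(2 * s) powr \<beta> * exp (- (k * s\<^sup>2)) \<le> (2 / sqrt k) powr \<beta> * beta_factor \<beta>"
proof (cases "\<beta> = 0")
  case True
  then show ?thesis using assms by (simp add: beta_factor_def)
next
  case False
  define w where "w = 2 * (k * s\<^sup>2) / \<beta>"
  have b: "\<beta> > 0" using False assms by simp
  have w: "w > 0" using assms b by (auto simp: w_def)
  have s2: "s\<^sup>2 = (\<beta> / 2) * w / k" using b assms by (simp add: w_def)
  have ks: "k * s\<^sup>2 = (\<beta> / 2) * w" using b by (simp add: w_def)
  have "2 * ln s = ln (s\<^sup>2)" using assms by (simp add: ln_realpow)
  also have "\<dots> = ln (\<beta> / 2) + ln w - ln k"
    unfolding s2 using b w assms by (simp add: ln_div ln_mult)
  finally have ls: "ln s = (ln (\<beta> / 2) + ln w - ln k) / 2" by simp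
  have "\<beta> * ln (2 * s) - k * s\<^sup>2
      = \<beta> * (ln 2 + (ln (\<beta> / 2) + ln w - ln k) / 2) - (\<beta> / 2) * w"
    using assms ls[symmetric] ks by (simp add: ln_mult)
  also have "\<dots> = \<beta> * (ln 2 - ln k / 2) + (\<beta> / 2) * (ln (\<beta> / 2) + (ln w - w))"
    by (simp add: field_simps)
  also have "\<dots> \<le> \<beta> * (ln 2 - ln k / 2) + (\<beta> / 2) * (ln (\<beta> / 2) + (- 1))"
    using b ln_le_minus_one[OF w] by (intro add_left_mono mult_left_mono) auto
  also have "\<dots> = \<beta> * ln (2 / sqrt k) + (\<beta> / 2) * ln (\<beta> / (2 * exp 1))"
    using b assms by (simp add: ln_div ln_mult ln_sqrt)
  finally have "exp (\<beta> * ln (2 * s) - k * s\<^sup>2)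
      \<le> exp (\<beta> * ln (2 / sqrt k) + (\<beta> / 2) * ln (\<beta> / (2 * exp 1)))"
    by simp
  then have "exp (\<beta> * ln (2 * s)) * exp (- (k * s\<^sup>2))
      \<le> exp (\<beta> * ln (2 / sqrt k)) * exp (\<beta> / 2 * ln (\<beta> / (2 * exp 1)))"
    unfolding exp_add[symmetric] by simp
  then show ?thesis
    using False assms by (simp add: beta_factor_def powr_def)
qed

section \<open>Counting tests\<close>

text \<open>A product measure is by construction the law of its own coordinate tuple, which is the
  characterization of independence through the joint law.\<close>

lemma indep_vars_PiM_coordinates:
  assumes "prob_space N" "finite I" "I \<noteq> {}"
  shows "prob_space.indep_vars (PiM I (\<lambda>_. N)) (\<lambda>_. N) (\<lambda>i z. z i) I"
proof -
  interpret PiM: prob_space "PiM I (\<lambda>_. N)"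
    using assms by (intro prob_space_PiM)
  have "distr (PiM I (\<lambda>_. N)) (PiM I (\<lambda>_. N)) (\<lambda>x. restrict x I)
      = distr (PiM I (\<lambda>_. N)) (PiM I (\<lambda>_. N)) (\<lambda>x. x)"
    by (intro distr_cong) (auto simp: space_PiM)
  also have "\<dots> = PiM I (\<lambda>_. N)"
    by (simp add: distr_id2)
  also have "\<dots> = PiM I (\<lambda>i. distr (PiM I (\<lambda>_. N)) N (\<lambda>z. z i))"
    using assms by (intro PiM_cong refl) (simp add: distr_PiM_component[of I "\<lambda>_. N"])
  finally show ?thesis
    using assms by (subst PiM.indep_vars_iff_distr_eq_PiM') auto
qed

lemma
  fixes N :: "'z measure" and n :: nat
  defines "M \<equiv> PiM {..<n} (\<lambda>_. N)"
  assumes N: "prob_space N" and E: "E \<in> sets N" and n: "1 \<le> n" and t: "0 \<le> t"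
  shows Hoeffding_count_ge:
      "measure M {z \<in> space M. real n * (measure N E + t) \<le> (\<Sum>i<n. indicator E (z i))}
        \<le> exp (- (2 * real n * t\<^sup>2))"
    and Hoeffding_count_le:
      "measure M {z \<in> space M. (\<Sum>i<n. indicator E (z i)) \<le> real n * (measure N E - t)}
        \<le> exp (- (2 * real n * t\<^sup>2))"
proof -
  interpret N: prob_space N by fact
  interpret M: prob_space M
    unfolding M_def using N by (intro prob_space_PiM)
  note [measurable] = E
  have ind: "M.indep_vars (\<lambda>_. borel) (\<lambda>i z. indicator E (z i) :: real) {..<n}"
    unfolding M_def
    by (rule prob_space.indep_vars_compose2[OF _ indep_vars_PiM_coordinates[OF N]])
       (use n in \<open>auto simp: lessThan_empty_iff intro!: prob_space_PiM N\<close>)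
  have mean: "M.expectation (\<lambda>z. indicator E (z i)) = measure N E" if "i < n" for i
  proof -
    have "M.expectation (\<lambda>z. indicator E (z i) :: real)
        = integral\<^sup>L (distr M N (\<lambda>z. z i)) (indicator E)"
      using that by (subst integral_distr) (auto simp: M_def)
    also have "distr M N (\<lambda>z. z i) = N"
      unfolding M_def using that N by (intro distr_PiM_component) auto
    finally show ?thesis by simp
  qed
  interpret Hoeffding_ineq M "{..<n}" "\<lambda>i z. indicator E (z i)" "\<lambda>_. 0" "\<lambda>_. 1"
      "real n * measure N E"
  proof unfold_locales
    show "real n * measure N E \<equiv> (\<Sum>i<n. M.expectation (\<lambda>z. indicator E (z i)))"
      by (rule eq_reflection) (simp add: mean)
  qed (use ind in \<open>auto simp: indicator_def\<close>)
  have e: "- 2 * (real n * t)\<^sup>2 / real n = - (2 * real n * t\<^sup>2)"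
    using n by (simp add: power2_eq_square)
  show "measure M {z \<in> space M. real n * (measure N E + t) \<le> (\<Sum>i<n. indicator E (z i))}
        \<le> exp (- (2 * real n * t\<^sup>2))"
    using Hoeffding_ineq_ge[of "real n * t"] n t e by (simp add: algebra_simps)
  show "measure M {z \<in> space M. (\<Sum>i<n. indicator E (z i)) \<le> real n * (measure N E - t)}
        \<le> exp (- (2 * real n * t\<^sup>2))"
    using Hoeffding_ineq_le[of "real n * t"] n t e by (simp add: algebra_simps)
qed

section \<open>Randomized response\<close>

definition bernoulli_real :: "real \<Rightarrow> real measure" where
  "bernoulli_real a = distr (measure_pmf (bernoulli_pmf a)) borel of_bool"

definition randomized_response :: "real \<Rightarrow> 'a set \<Rightarrow> 'a \<Rightarrow> real measure" where
  "randomized_response \<epsilon> A x =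
     bernoulli_real (if x \<in> A then exp \<epsilon> / (exp \<epsilon> + 1) else 1 / (exp \<epsilon> + 1))"

lemma bernoulli_real_in_prob_algebra: "bernoulli_real a \<in> space (prob_algebra borel)"
  by (simp add: space_prob_algebra bernoulli_real_def measure_pmf.prob_space_distr)

lemma measure_bernoulli_real:
  assumes "0 \<le> a" "a \<le> 1" "B \<in> sets borel"
  shows "measure (bernoulli_real a) B = a * indicator B 1 + (1 - a) * indicator B 0"
proof -
  have "measure (bernoulli_real a) B = measure_pmf.expectation (bernoulli_pmf a) (indicator (of_bool -` B))"
    using assms by (simp add: bernoulli_real_def measure_distr)
  also have "\<dots> = a * indicator B 1 + (1 - a) * indicator B 0"
    using assms by (subst integral_bernoulli_pmf) (auto simp: indicator_def)
  finally show ?thesis .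
qed

lemma randomized_response_measurable:
  assumes "A \<in> sets X"
  shows "randomized_response \<epsilon> A \<in> X \<rightarrow>\<^sub>M prob_algebra borel"
proof -
  have "(\<lambda>x. if x \<in> A then bernoulli_real (exp \<epsilon> / (exp \<epsilon> + 1)) else bernoulli_real (1 / (exp \<epsilon> + 1)))
      \<in> X \<rightarrow>\<^sub>M prob_algebra borel"
    using assms bernoulli_real_in_prob_algebra by (intro measurable_If measurable_const) auto
  also have "(\<lambda>x. if x \<in> A then bernoulli_real (exp \<epsilon> / (exp \<epsilon> + 1)) else bernoulli_real (1 / (exp \<epsilon> + 1)))
      = randomized_response \<epsilon> A"
    by (auto simp: randomized_response_def)
  finally show ?thesis .
qed

lemma measure_randomized_response:
  assumes "B \<in> sets borel"
  shows "measure (randomized_response \<epsilon> A x) B =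
    (if x \<in> A then (exp \<epsilon> * indicator B 1 + indicator B 0) / (exp \<epsilon> + 1)
     else (indicator B 1 + exp \<epsilon> * indicator B 0) / (exp \<epsilon> + 1))"
proof -
  have "exp \<epsilon> + 1 > 0" by (simp add: add_pos_pos)
  then have "1 - exp \<epsilon> / (exp \<epsilon> + 1) = 1 / (exp \<epsilon> + 1)" "1 - 1 / (exp \<epsilon> + 1) = exp \<epsilon> / (exp \<epsilon> + 1)"
    "exp \<epsilon> / (exp \<epsilon> + 1) \<le> 1" "1 / (exp \<epsilon> + 1) \<le> 1"
    by (auto simp: divide_simps)
  then show ?thesis
    using assms unfolding randomized_response_def
    by (cases "x \<in> A") (simp_all only: if_True if_False measure_bernoulli_real, simp_all add: add_divide_distrib)
qed

text \<open>Each output value has probability \<open>e / (e + 1)\<close> or \<open>1 / (e + 1)\<close> with \<open>e = exp \<epsilon>\<close>, so no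
  likelihood ratio exceeds \<open>e\<close>.\<close>

lemma randomized_response_ldp:
  assumes "A \<in> sets X" "0 \<le> \<epsilon>"
  shows "randomized_response \<epsilon> A \<in> ldp_channels X borel \<epsilon>"
proof -
  define e where "e = exp \<epsilon>"
  have e: "1 \<le> e" using assms by (simp add: e_def)
  have e2: "1 * 1 \<le> e * e" using e by (intro mult_mono) auto
  have "measure (randomized_response \<epsilon> A x) B \<le> exp \<epsilon> * measure (randomized_response \<epsilon> A x') B"
    if "B \<in> sets borel" for x x' and B :: "real set"
  proof -
    have "(if x \<in> A then e * indicator B 1 + indicator B 0 else indicator B 1 + e * indicator B 0) / (e + 1)
      \<le> e * (if x' \<in> A then e * indicator B 1 + indicator B 0 else indicator B 1 + e * indicator B 0) / (e + 1)"
      using e e2 by (intro divide_right_mono) (auto simp: indicator_def algebra_simps)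
    then show ?thesis
      unfolding measure_randomized_response[OF that] e_def[symmetric] by (simp split: if_splits)
  qed
  then show ?thesis
    using randomized_response_measurable[OF assms(1)] by (auto simp: ldp_channels_def)
qed

lemma
  assumes P: "prob_space P" and A: "A \<in> sets P"
  shows prob_space_bind_randomized_response: "prob_space (P \<bind> randomized_response \<epsilon> A)"
    and sets_bind_randomized_response: "sets (P \<bind> randomized_response \<epsilon> A) = sets borel"
    and measure_bind_randomized_response:
      "measure (P \<bind> randomized_response \<epsilon> A) {1}
        = 1 / (exp \<epsilon> + 1) + (exp \<epsilon> - 1) / (exp \<epsilon> + 1) * measure P A"
proof -
  interpret P: prob_space P by fact
  have Q: "randomized_response \<epsilon> A \<in> P \<rightarrow>\<^sub>M prob_algebra borel"
    using A by (rule randomized_response_measurable)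
  then have Qs: "randomized_response \<epsilon> A \<in> P \<rightarrow>\<^sub>M subprob_algebra borel"
    by (rule measurable_prob_algebraD)
  have "P \<in> space (prob_algebra P)" by (simp add: space_prob_algebra P)
  show "prob_space (P \<bind> randomized_response \<epsilon> A)"
    using prob_space_bind'[OF \<open>P \<in> space (prob_algebra P)\<close> Q] .
  show "sets (P \<bind> randomized_response \<epsilon> A) = sets borel"
    using sets_bind'[OF \<open>P \<in> space (prob_algebra P)\<close> Q] .
  have "measure (P \<bind> randomized_response \<epsilon> A) {1} = (\<integral>x. measure (randomized_response \<epsilon> A x) {1} \<partial>P)"
    by (rule P.measure_bind[OF Qs]) simp
  also have "\<dots> = (\<integral>x. 1 / (exp \<epsilon> + 1) + (exp \<epsilon> - 1) / (exp \<epsilon> + 1) * indicator A x \<partial>P)"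
    by (intro Bochner_Integration.integral_cong refl)
       (simp add: measure_randomized_response indicator_def diff_divide_distrib)
  also have "\<dots> = 1 / (exp \<epsilon> + 1) + (exp \<epsilon> - 1) / (exp \<epsilon> + 1) * measure P A"
    using A by (subst Bochner_Integration.integral_add) (auto simp: P.prob_space less_top[symmetric])
  finally show "measure (P \<bind> randomized_response \<epsilon> A) {1}
        = 1 / (exp \<epsilon> + 1) + (exp \<epsilon> - 1) / (exp \<epsilon> + 1) * measure P A" .
qed

text \<open>The quotient is \<open>tanh (\<epsilon> / 2)\<close>. The denominator is at most \<open>exp 2 + 1 \<le> 10\<close>, and this is where
  the restriction to \<open>\<epsilon> \<le> 2\<close> enters.\<close>

lemma randomized_response_contraction:
  fixes \<epsilon> :: real
  assumes "0 < \<epsilon>" "\<epsilon> \<le> 2"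
  shows "\<epsilon> / 10 \<le> (exp \<epsilon> - 1) / (exp \<epsilon> + 1)"
proof -
  have "exp \<epsilon> \<le> exp 1 * exp (1::real)"
    using assms by (simp add: exp_add[symmetric])
  also have "\<dots> \<le> 3 * 3" by (intro mult_mono exp_le) auto
  finally have "exp \<epsilon> + 1 \<le> 10" by simp
  moreover have "\<epsilon> \<le> exp \<epsilon> - 1" using exp_ge_add_one_self[of \<epsilon>] by linarith
  ultimately show ?thesis
    using assms by (intro frac_le) (auto intro: add_pos_pos)
qed

text \<open>The test counts outputs equal to \<open>1\<close> and compares with \<open>n c\<close>, where \<open>c\<close> is the midpoint of the
  two probabilities of that output. An error means a deviation by \<open>n d\<close> with \<open>2 d\<close> the gap between
  them, and contraction gives \<open>d \<ge> \<epsilon> (P1 A - P0 A) / 20\<close>; since \<open>2 / 20\<^sup>2 = 1 / 200\<close>,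
  Hoeffding's inequality yields the exponent.\<close>

lemma two_point_risk_le:
  fixes P0 P1 X :: "'a measure" and v0 v1 :: real
  assumes P: "prob_space P0" "prob_space P1" "sets P0 = sets X" "sets P1 = sets X"
    and A: "A \<in> sets X" and le: "measure P0 A \<le> measure P1 A"
    and L: "symmetric_loss L" and \<epsilon>: "0 < \<epsilon>" "\<epsilon> \<le> 2" and n: "1 \<le> n"
  defines "R \<equiv> ennreal (L (v1 - v0)) *
    ennreal (exp (- (real n * \<epsilon>\<^sup>2 * (measure P1 A - measure P0 A)\<^sup>2 / 200)))"
  obtains est where "est \<in> PiM {..<n} (\<lambda>_. borel) \<rightarrow>\<^sub>M borel"
    "private_risk n L (randomized_response \<epsilon> A) P0 est v0 \<le> R"
    "private_risk n L (randomized_response \<epsilon> A) P1 est v1 \<le> R"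
proof -
  define Q where "Q = randomized_response \<epsilon> A"
  define q where "q P = measure (P \<bind> Q) {1}" for P :: "'a measure"
  define d where "d = (q P1 - q P0) / 2"
  define c where "c = (q P0 + q P1) / 2"
  define S where "S z = (\<Sum>i<n. indicator {1} (z i) :: real)" for z :: "nat \<Rightarrow> real"
  define est where "est z = (if real n * c \<le> S z then v1 else v0)" for z
  have q: "q P0 + d = c" "q P1 - d = c" by (auto simp: c_def d_def field_simps)
  have AP: "A \<in> sets P0" "A \<in> sets P1" using P A by auto
  have NP: "prob_space (P0 \<bind> Q)" "prob_space (P1 \<bind> Q)"
    and NS: "sets (P0 \<bind> Q) = sets borel" "sets (P1 \<bind> Q) = sets borel"
    unfolding Q_def using P AP
    by (simp_all only: prob_space_bind_randomized_response sets_bind_randomized_response)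
  have "q P1 - q P0 = (exp \<epsilon> - 1) / (exp \<epsilon> + 1) * (measure P1 A - measure P0 A)"
    unfolding q_def Q_def measure_bind_randomized_response[OF P(1) AP(1)]
      measure_bind_randomized_response[OF P(2) AP(2)] right_diff_distrib by linarith
  moreover have "2 * d = q P1 - q P0" by (simp add: d_def)
  ultimately have "2 * d = (exp \<epsilon> - 1) / (exp \<epsilon> + 1) * (measure P1 A - measure P0 A)"
    by (simp only:)
  moreover have "\<dots> \<ge> \<epsilon> / 10 * (measure P1 A - measure P0 A)"
    using randomized_response_contraction[OF \<epsilon>] le by (intro mult_right_mono) auto
  ultimately have "\<epsilon> / 10 * (measure P1 A - measure P0 A) \<le> 2 * d" by (simp only:)
  then have d: "\<epsilon> * (measure P1 A - measure P0 A) / 20 \<le> d" by simp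
  moreover have "0 \<le> \<epsilon> * (measure P1 A - measure P0 A) / 20" using \<epsilon> le by simp
  ultimately have d0: "0 \<le> d" and "(\<epsilon> * (measure P1 A - measure P0 A) / 20)\<^sup>2 \<le> d\<^sup>2"
    by (linarith, intro power_mono) auto
  then have "real n * (\<epsilon> * (measure P1 A - measure P0 A) / 20)\<^sup>2 \<le> real n * d\<^sup>2"
    by (intro mult_left_mono) auto
  then have exple: "exp (- (2 * real n * d\<^sup>2))
      \<le> exp (- (real n * \<epsilon>\<^sup>2 * (measure P1 A - measure P0 A)\<^sup>2 / 200))"
    by (simp add: power_mult_distrib power_divide)
  have L0: "L 0 = 0" and Lsym: "L (v0 - v1) = L (v1 - v0)"
    using L unfolding symmetric_loss_def by (auto, metis minus_diff_eq)
  have Smeas: "S \<in> borel_measurable (PiM {..<n} (\<lambda>_. borel))"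
    unfolding S_def by measurable
  have estmeas: "est \<in> PiM {..<n} (\<lambda>_. borel) \<rightarrow>\<^sub>M borel"
    unfolding est_def using Smeas by measurable
  (* A wrong answer costs exactly L (v1 - v0) and a right one costs L 0 = 0, so the risk under
     either law is the cost times the probability of an event E containing the errors. *)
  have risk: "private_risk n L Q P' est v \<le> R"
    if NS: "sets (P' \<bind> Q) = sets borel"
      and E: "\<And>z. L (est z - v) \<noteq> 0 \<Longrightarrow> z \<in> E \<and> L (est z - v) = L (v1 - v0)"
      and ME: "{z \<in> space (PiM {..<n} (\<lambda>_. borel)). z \<in> E} \<in> sets (PiM {..<n} (\<lambda>_. borel))"
      and NP: "prob_space (P' \<bind> Q)"
      and err: "measure (private_law n Q P') {z \<in> space (private_law n Q P'). z \<in> E}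
        \<le> exp (- (2 * real n * d\<^sup>2))" for P' v E
  proof -
    let ?M = "private_law n Q P'"
    have sM: "sets ?M = sets (PiM {..<n} (\<lambda>_. borel :: real measure))"
      unfolding private_law_def using NS by (intro sets_PiM_cong) auto
    interpret M: prob_space ?M
      unfolding private_law_def using NP by (intro prob_space_PiM)
    let ?E = "{z \<in> space ?M. z \<in> E}"
    have mE: "?E \<in> sets ?M" using ME sM sets_eq_imp_space_eq[OF sM] by simp
    have "private_risk n L Q P' est v \<le> (\<integral>\<^sup>+z. ennreal (L (v1 - v0)) * indicator ?E z \<partial>?M)"
      unfolding private_risk_def
    proof (intro nn_integral_mono)
      fix z assume "z \<in> space ?M"
      then show "ennreal (L (est z - v)) \<le> ennreal (L (v1 - v0)) * indicator ?E z"
        using E[of z] by (cases "L (est z - v) = 0") auto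
    qed
    also have "\<dots> = ennreal (L (v1 - v0)) * emeasure ?M ?E"
      using mE by (rule nn_integral_cmult_indicator)
    also have "\<dots> \<le> R"
      unfolding R_def M.emeasure_eq_measure
      using order_trans[OF err exple] by (intro mult_left_mono ennreal_leI) auto
    finally show ?thesis .
  qed
  have "private_risk n L Q P0 est v0 \<le> R"
  proof (rule risk[where E = "{z. real n * c \<le> S z}"])
    have "{1} \<in> sets (P0 \<bind> Q)" using NS by simp
    from Hoeffding_count_ge[OF NP(1) this n d0]
    show "measure (private_law n Q P0) {z \<in> space (private_law n Q P0). z \<in> {z. real n * c \<le> S z}}
        \<le> exp (- (2 * real n * d\<^sup>2))"
      by (simp add: private_law_def S_def q_def[symmetric] q)
  qed (use NS NP Smeas L0 in \<open>auto simp: est_def split: if_splits\<close>)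
  moreover have "private_risk n L Q P1 est v1 \<le> R"
  proof (rule risk[where E = "{z. S z \<le> real n * c}"])
    have "{1} \<in> sets (P1 \<bind> Q)" using NS by simp
    from Hoeffding_count_le[OF NP(2) this n d0]
    show "measure (private_law n Q P1) {z \<in> space (private_law n Q P1). z \<in> {z. S z \<le> real n * c}}
        \<le> exp (- (2 * real n * d\<^sup>2))"
      by (simp add: private_law_def S_def q_def[symmetric] q)
  qed (use NS NP Smeas L0 Lsym in \<open>auto simp: est_def split: if_splits\<close>)
  ultimately show thesis using estmeas that unfolding Q_def by blast
qed

section \<open>Total variation\<close>

lemma integrable_prob_density:
  assumes "f \<in> borel_measurable M" "\<forall>x\<in>space M. 0 \<le> f x" "prob_space (density M (\<lambda>x. ennreal (f x)))"
  shows "integrable M f" "integral\<^sup>L M f = (1::real)"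
proof -
  have "(\<integral>\<^sup>+x. ennreal (f x) \<partial>M) = emeasure (density M (\<lambda>x. ennreal (f x))) (space M)"
    using assms(1) by (subst emeasure_density) (auto intro!: nn_integral_cong)
  also have "\<dots> = 1"
    using prob_space.emeasure_space_1[OF assms(3)] by simp
  finally have *: "(\<integral>\<^sup>+x. ennreal (f x) \<partial>M) = ennreal 1" by simp
  then show "integrable M f"
    using assms by (intro integrableI_nn_integral_finite[OF _ _ *]) auto
  show "integral\<^sup>L M f = 1"
    using assms * by (intro integral_eq_nn_integral[THEN trans]) auto
qed

text \<open>Since \<open>f - g\<close> integrates to zero, its positive part, which lives on \<open>A\<close>, carries half of
  \<open>\<integral>\<bar>f - g\<bar>\<close>.\<close>

lemma total_variation_attained:
  assumes f: "integrable M f" "\<forall>x\<in>space M. 0 \<le> f x" and g: "integrable M g" "\<forall>x\<in>space M. 0 \<le> g x"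
    and eq: "integral\<^sup>L M f = integral\<^sup>L M (g :: _ \<Rightarrow> real)"
  defines "A \<equiv> {x \<in> space M. g x < f x}"
  shows "A \<in> sets M"
    "measure (density M (\<lambda>x. ennreal (f x))) A - measure (density M (\<lambda>x. ennreal (g x))) A
      = (\<integral>x. \<bar>f x - g x\<bar> \<partial>M) / 2"
proof -
  have [measurable]: "f \<in> borel_measurable M" "g \<in> borel_measurable M" using f g by auto
  show A[measurable]: "A \<in> sets M" unfolding A_def by measurable
  have m: "measure (density M (\<lambda>x. ennreal (h x))) A = (\<integral>x. h x * indicator A x \<partial>M)"
    if h: "integrable M h" "\<forall>x\<in>space M. 0 \<le> h x" for h :: "_ \<Rightarrow> real"
  proof -
    have [measurable]: "h \<in> borel_measurable M" using h by auto
    have "emeasure (density M (\<lambda>x. ennreal (h x))) A = (\<integral>\<^sup>+x. ennreal (h x * indicator A x) \<partial>M)"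
      by (subst emeasure_density) (auto intro!: nn_integral_cong simp: indicator_def)
    also have "\<dots> = ennreal (\<integral>x. h x * indicator A x \<partial>M)"
      using h A by (intro nn_integral_eq_integral integrable_real_mult_indicator) (auto simp: indicator_def)
    finally show ?thesis
      using h by (simp add: measure_def enn2real_ennreal integral_nonneg_AE)
  qed
  have "(\<integral>x. \<bar>f x - g x\<bar> \<partial>M)
      = (\<integral>x. 2 * (f x * indicator A x - g x * indicator A x) - (f x - g x) \<partial>M)"
    by (intro Bochner_Integration.integral_cong) (auto simp: A_def indicator_def)
  also have "\<dots> = 2 * ((\<integral>x. f x * indicator A x \<partial>M) - (\<integral>x. g x * indicator A x \<partial>M))"
    using f g eq A by (simp add: integrable_real_mult_indicator)
  finally show "measure (density M (\<lambda>x. ennreal (f x))) A - measure (density M (\<lambda>x. ennreal (g x))) A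
      = (\<integral>x. \<bar>f x - g x\<bar> \<partial>M) / 2"
    using m[OF f] m[OF g] by simp
qed

text \<open>Pointwise, \<open>(\<surd>f - \<surd>g)\<^sup>2 \<le> \<bar>\<surd>f - \<surd>g\<bar> (\<surd>f + \<surd>g) = \<bar>f - g\<bar>\<close>. Through this comparison
  identifiability in Hellinger distance controls the total variation distance.\<close>

lemma hellinger_sq_le_half_L1:
  assumes f: "integrable M f" "\<forall>x\<in>space M. 0 \<le> f x" and g: "integrable M g" "\<forall>x\<in>space M. 0 \<le> g x"
  shows "hellinger_sq M f g \<le> (\<integral>x. \<bar>f x - g x\<bar> \<partial>M) / 2"
proof -
  have [measurable]: "f \<in> borel_measurable M" "g \<in> borel_measurable M" using f g by auto
  have le: "(sqrt (f x) - sqrt (g x))\<^sup>2 \<le> \<bar>f x - g x\<bar>" if "x \<in> space M" for x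
  proof -
    have p: "0 \<le> f x" "0 \<le> g x" using f g that by auto
    have "(sqrt (f x) - sqrt (g x))\<^sup>2 = \<bar>sqrt (f x) - sqrt (g x)\<bar> * \<bar>sqrt (f x) - sqrt (g x)\<bar>"
      by (simp add: power2_eq_square)
    also have "\<dots> \<le> \<bar>sqrt (f x) - sqrt (g x)\<bar> * \<bar>sqrt (f x) + sqrt (g x)\<bar>"
      using p by (intro mult_left_mono order_trans[OF abs_triangle_ineq4]) auto
    also have "\<dots> = \<bar>(sqrt (f x))\<^sup>2 - (sqrt (g x))\<^sup>2\<bar>"
      by (simp add: abs_mult[symmetric] power2_eq_square algebra_simps)
    finally show ?thesis using p by simp
  qed
  have i: "integrable M (\<lambda>x. \<bar>f x - g x\<bar>)" using f g by auto
  have "integrable M (\<lambda>x. (sqrt (f x) - sqrt (g x))\<^sup>2)"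
    by (rule Bochner_Integration.integrable_bound[OF i]) (auto intro!: AE_I2 dest!: le)
  then show ?thesis
    unfolding hellinger_sq_def using i le integral_mono[of M _ "\<lambda>x. \<bar>f x - g x\<bar>"] by auto
qed

text \<open>By the triangle inequality the \<open>L\<^sup>1\<close> distance is at least the norm \<open>\<bar>h\<bar> J\<close> of the linear term
  minus the remainder, and the remainder is eventually at most \<open>\<bar>h\<bar> J / 2\<close> because \<open>J > 0\<close>.\<close>

lemma L1_distance_local_lower_bound:
  assumes fam: "dominated_family \<mu> \<Theta> p" and \<theta>0: "\<theta>0 \<in> \<Theta>"
    and dif: "L1_differentiable_at \<mu> \<Theta> p \<theta>0 score"
    and J: "L1_information \<mu> p \<theta>0 score > 0"
  obtains r where "r > 0" "\<And>\<theta>. \<theta> \<in> \<Theta> \<Longrightarrow> \<theta> \<noteq> \<theta>0 \<Longrightarrow> \<bar>\<theta> - \<theta>0\<bar> < r \<Longrightarrow>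
    \<bar>\<theta> - \<theta>0\<bar> * L1_information \<mu> p \<theta>0 score / 2 \<le> (\<integral>x. \<bar>p \<theta> x - p \<theta>0 x\<bar> \<partial>\<mu>)"
proof -
  let ?J = "L1_information \<mu> p \<theta>0 score"
  let ?R = "\<lambda>h x. p (\<theta>0 + h) x - p \<theta>0 x - h * score x * p \<theta>0 x"
  have pm: "p \<theta> \<in> borel_measurable \<mu>" and pn: "\<forall>x\<in>space \<mu>. 0 \<le> p \<theta> x"
    and pp: "prob_space (density \<mu> (\<lambda>x. ennreal (p \<theta> x)))" if "\<theta> \<in> \<Theta>" for \<theta>
    using fam that unfolding dominated_family_def distr_of_def by auto
  have pint: "integrable \<mu> (p \<theta>)" if "\<theta> \<in> \<Theta>" for \<theta>
    using integrable_prob_density(1)[OF pm pn pp] that by blast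
  have sm: "score \<in> borel_measurable \<mu>" and si: "integrable (distr_of \<mu> p \<theta>0) score"
    using dif unfolding L1_differentiable_at_def by auto
  have spi: "integrable \<mu> (\<lambda>x. score x * p \<theta>0 x)"
    using si pm[OF \<theta>0] pn[OF \<theta>0] sm unfolding distr_of_def
    by (subst (asm) integrable_density) (auto simp: mult.commute)
  have Jeq: "?J = (\<integral>x. \<bar>score x * p \<theta>0 x\<bar> \<partial>\<mu>)"
    unfolding L1_information_def distr_of_def using pm[OF \<theta>0] pn[OF \<theta>0] sm
    by (subst integral_density) (auto intro!: Bochner_Integration.integral_cong simp: abs_mult)
  have "(\<lambda>h. \<integral>x. \<bar>?R h x\<bar> \<partial>\<mu>) \<in> o[at 0 within {h. \<theta>0 + h \<in> \<Theta>}](\<lambda>h. \<bar>h\<bar>)"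
    using dif unfolding L1_differentiable_at_def by auto
  from landau_o.smallD[OF this, of "?J / 2"] J
  have "eventually (\<lambda>h. norm (\<integral>x. \<bar>?R h x\<bar> \<partial>\<mu>) \<le> ?J / 2 * norm \<bar>h\<bar>) (at 0 within {h. \<theta>0 + h \<in> \<Theta>})"
    by simp
  then obtain r where r: "r > 0" "\<And>h. \<theta>0 + h \<in> \<Theta> \<Longrightarrow> h \<noteq> 0 \<Longrightarrow> \<bar>h\<bar> < r \<Longrightarrow>
      (\<integral>x. \<bar>?R h x\<bar> \<partial>\<mu>) \<le> ?J / 2 * \<bar>h\<bar>"
    unfolding eventually_at by (fastforce simp: dist_real_def)
  show thesis
  proof (rule that[OF r(1)])
    fix \<theta> assume \<theta>: "\<theta> \<in> \<Theta>" "\<theta> \<noteq> \<theta>0" "\<bar>\<theta> - \<theta>0\<bar> < r"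
    define h where "h = \<theta> - \<theta>0"
    have h: "\<theta>0 + h = \<theta>" by (simp add: h_def)
    have Ri: "integrable \<mu> (\<lambda>x. \<bar>?R h x\<bar>)"
      using pint[OF \<theta>(1)] pint[OF \<theta>0] integrable_mult_right[OF spi, of h] unfolding h
      by (intro integrable_abs Bochner_Integration.integrable_diff) (auto simp: mult.assoc)
    have Di: "integrable \<mu> (\<lambda>x. \<bar>p \<theta> x - p \<theta>0 x\<bar>)"
      using pint[OF \<theta>(1)] pint[OF \<theta>0] by auto
    have "\<bar>h\<bar> * ?J = (\<integral>x. \<bar>h\<bar> * \<bar>score x * p \<theta>0 x\<bar> \<partial>\<mu>)"
      unfolding Jeq by simp
    also have "\<dots> \<le> (\<integral>x. \<bar>p \<theta> x - p \<theta>0 x\<bar> + \<bar>?R h x\<bar> \<partial>\<mu>)"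
    proof (rule integral_mono)
      show "integrable \<mu> (\<lambda>x. \<bar>h\<bar> * \<bar>score x * p \<theta>0 x\<bar>)"
        by (intro integrable_mult_right integrable_abs spi)
      show "integrable \<mu> (\<lambda>x. \<bar>p \<theta> x - p \<theta>0 x\<bar> + \<bar>?R h x\<bar>)"
        using Di Ri by (rule Bochner_Integration.integrable_add)
      fix x
      have "\<bar>h\<bar> * \<bar>score x * p \<theta>0 x\<bar> = \<bar>h * score x * p \<theta>0 x\<bar>"
        by (simp add: abs_mult)
      also have "\<dots> \<le> \<bar>p \<theta> x - p \<theta>0 x\<bar> + \<bar>?R h x\<bar>" unfolding h by linarith
      finally show "\<bar>h\<bar> * \<bar>score x * p \<theta>0 x\<bar> \<le> \<bar>p \<theta> x - p \<theta>0 x\<bar> + \<bar>?R h x\<bar>" .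
    qed
    also have "\<dots> = (\<integral>x. \<bar>p \<theta> x - p \<theta>0 x\<bar> \<partial>\<mu>) + (\<integral>x. \<bar>?R h x\<bar> \<partial>\<mu>)"
      using Di Ri by (rule Bochner_Integration.integral_add)
    also have "\<dots> \<le> (\<integral>x. \<bar>p \<theta> x - p \<theta>0 x\<bar> \<partial>\<mu>) + ?J / 2 * \<bar>h\<bar>"
      using r(2)[of h] \<theta> h by (auto simp: h_def)
    finally show "\<bar>\<theta> - \<theta>0\<bar> * ?J / 2 \<le> (\<integral>x. \<bar>p \<theta> x - p \<theta>0 x\<bar> \<partial>\<mu>)"
      unfolding h_def by (simp add: field_simps)
  qed
qed

section \<open>The local minimax bound\<close>

text \<open>Differentiability at \<open>\<theta>0\<close> bounds the difference quotients by \<open>\<bar>\<psi>' \<theta>0\<bar>\<close> plus any positive slack;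
  a nonzero derivative can itself serve as the slack, which makes the bound a multiple of
  \<open>\<bar>\<psi>' \<theta>0\<bar>\<close>.\<close>

lemma C1_near_locally_Lipschitz:
  assumes "C1_near \<Theta> \<theta>0 \<psi> \<psi>'" "\<theta>0 \<in> \<Theta>" "\<psi>' \<theta>0 \<noteq> 0"
  obtains r where "r > 0"
    "\<And>\<theta>. \<theta> \<in> \<Theta> \<Longrightarrow> \<bar>\<theta> - \<theta>0\<bar> < r \<Longrightarrow> \<bar>\<psi> \<theta> - \<psi> \<theta>0\<bar> \<le> 2 * \<bar>\<psi>' \<theta>0\<bar> * \<bar>\<theta> - \<theta>0\<bar>"
proof -
  have "(\<psi> has_real_derivative \<psi>' \<theta>0) (at \<theta>0 within \<Theta>)"
    using assms unfolding C1_near_def by auto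
  then have "((\<lambda>\<theta>. (\<psi> \<theta> - \<psi> \<theta>0) / (\<theta> - \<theta>0)) \<longlongrightarrow> \<psi>' \<theta>0) (at \<theta>0 within \<Theta>)"
    by (simp add: has_field_derivative_iff)
  then have "eventually (\<lambda>\<theta>. dist ((\<psi> \<theta> - \<psi> \<theta>0) / (\<theta> - \<theta>0)) (\<psi>' \<theta>0) < \<bar>\<psi>' \<theta>0\<bar>) (at \<theta>0 within \<Theta>)"
    using assms(3) by (intro tendstoD) auto
  then obtain r where r: "r > 0" "\<And>\<theta>. \<theta> \<in> \<Theta> \<Longrightarrow> \<theta> \<noteq> \<theta>0 \<Longrightarrow> \<bar>\<theta> - \<theta>0\<bar> < r \<Longrightarrow>
      dist ((\<psi> \<theta> - \<psi> \<theta>0) / (\<theta> - \<theta>0)) (\<psi>' \<theta>0) < \<bar>\<psi>' \<theta>0\<bar>"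
    unfolding eventually_at by (fastforce simp: dist_real_def)
  show thesis
  proof (rule that[OF r(1)])
    fix \<theta> assume \<theta>: "\<theta> \<in> \<Theta>" "\<bar>\<theta> - \<theta>0\<bar> < r"
    show "\<bar>\<psi> \<theta> - \<psi> \<theta>0\<bar> \<le> 2 * \<bar>\<psi>' \<theta>0\<bar> * \<bar>\<theta> - \<theta>0\<bar>"
    proof (cases "\<theta> = \<theta>0")
      case False
      have "\<bar>(\<psi> \<theta> - \<psi> \<theta>0) / (\<theta> - \<theta>0)\<bar> \<le> 2 * \<bar>\<psi>' \<theta>0\<bar>"
        using r(2)[OF \<theta>(1) False \<theta>(2)] unfolding dist_real_def by linarith
      then show ?thesis using False by (simp add: abs_divide divide_le_eq)
    qed simp
  qed
qed

lemma loss_le_loss_diam: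
  assumes "symmetric_loss L" "a \<in> S" "b \<in> S"
  shows "ennreal (L (a - b)) \<le> loss_diam L S"
proof (cases "bounded S")
  case True
  have "\<bar>a - b\<bar> \<le> diameter S"
    using diameter_bounded_bound[OF True assms(2,3)] by (simp add: dist_real_def)
  then show ?thesis
    using True symmetric_loss_mono[OF assms(1)] by (auto simp: loss_diam_def intro!: ennreal_leI)
next
  case False
  then show ?thesis by (auto simp: loss_diam_def intro: SUP_upper)
qed

text \<open>Randomized response on \<open>{p \<theta>1 > p \<theta>0}\<close> is fed into the two-point test. The bound is stated for
  any lower bound \<open>T\<close> on the total variation distance, as the near and the far alternatives supply
  different ones.\<close>

lemma ldp_two_point_bound:
  assumes fam: "dominated_family \<mu> \<Theta> p" and \<theta>: "\<theta>0 \<in> \<Theta>" "\<theta>1 \<in> \<Theta>"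
    and L: "symmetric_loss L" and \<epsilon>: "0 < \<epsilon>" "\<epsilon> \<le> 2" and n: "1 \<le> n"
    and T: "0 \<le> T" "T \<le> (\<integral>x. \<bar>p \<theta>1 x - p \<theta>0 x\<bar> \<partial>\<mu>) / 2"
  shows "(INF (est, Q) \<in> (PiM {..<n} (\<lambda>_. borel) \<rightarrow>\<^sub>M borel) \<times> ldp_channels \<mu> (borel :: real measure) \<epsilon>.
        MAX \<theta>\<in>{\<theta>0, \<theta>1}. private_risk n L Q (distr_of \<mu> p \<theta>) est (\<psi> \<theta>))
      \<le> ennreal (L (\<psi> \<theta>1 - \<psi> \<theta>0)) * ennreal (exp (- (real n * \<epsilon>\<^sup>2 * T\<^sup>2 / 200)))"
    (is "_ \<le> ?R")
proof -
  have pm: "p \<theta> \<in> borel_measurable \<mu>" and pn: "\<forall>x\<in>space \<mu>. 0 \<le> p \<theta> x"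
    and pp: "prob_space (density \<mu> (\<lambda>x. ennreal (p \<theta> x)))" if "\<theta> \<in> \<Theta>" for \<theta>
    using fam that unfolding dominated_family_def distr_of_def by auto
  note I = integrable_prob_density[OF pm pn pp]
  define A where "A = {x \<in> space \<mu>. p \<theta>0 x < p \<theta>1 x}"
  define D where "D = measure (distr_of \<mu> p \<theta>1) A - measure (distr_of \<mu> p \<theta>0) A"
  have A: "A \<in> sets \<mu>" and D: "D = (\<integral>x. \<bar>p \<theta>1 x - p \<theta>0 x\<bar> \<partial>\<mu>) / 2"
    unfolding A_def D_def distr_of_def using \<theta> I pn
    using total_variation_attained[OF I(1)[OF \<theta>(2)] pn[OF \<theta>(2)] I(1)[OF \<theta>(1)] pn[OF \<theta>(1)]] by auto
  have TD: "T \<le> D" using T D by simp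
  have D0: "measure (distr_of \<mu> p \<theta>0) A \<le> measure (distr_of \<mu> p \<theta>1) A"
    using TD T unfolding D_def by linarith
  obtain est where est: "est \<in> PiM {..<n} (\<lambda>_. borel) \<rightarrow>\<^sub>M borel"
    "private_risk n L (randomized_response \<epsilon> A) (distr_of \<mu> p \<theta>0) est (\<psi> \<theta>0)
      \<le> ennreal (L (\<psi> \<theta>1 - \<psi> \<theta>0)) * ennreal (exp (- (real n * \<epsilon>\<^sup>2 * D\<^sup>2 / 200)))"
    "private_risk n L (randomized_response \<epsilon> A) (distr_of \<mu> p \<theta>1) est (\<psi> \<theta>1)
      \<le> ennreal (L (\<psi> \<theta>1 - \<psi> \<theta>0)) * ennreal (exp (- (real n * \<epsilon>\<^sup>2 * D\<^sup>2 / 200)))"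
    unfolding D_def
    by (rule two_point_risk_le[OF _ _ _ _ A D0 L \<epsilon> n, where ?v0.0 = "\<psi> \<theta>0" and ?v1.0 = "\<psi> \<theta>1"])
       (use pp \<theta> in \<open>auto simp: distr_of_def\<close>)
  have "real n * \<epsilon>\<^sup>2 * T\<^sup>2 \<le> real n * \<epsilon>\<^sup>2 * D\<^sup>2"
    using TD T by (intro mult_left_mono power_mono) auto
  then have "ennreal (L (\<psi> \<theta>1 - \<psi> \<theta>0)) * ennreal (exp (- (real n * \<epsilon>\<^sup>2 * D\<^sup>2 / 200))) \<le> ?R"
    by (intro mult_left_mono ennreal_leI) auto
  then have "(MAX \<theta>\<in>{\<theta>0, \<theta>1}. private_risk n L (randomized_response \<epsilon> A) (distr_of \<mu> p \<theta>) est (\<psi> \<theta>)) \<le> ?R"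
    using est by (auto intro: order_trans)
  moreover have "(est, randomized_response \<epsilon> A)
      \<in> (PiM {..<n} (\<lambda>_. borel) \<rightarrow>\<^sub>M borel) \<times> ldp_channels \<mu> borel \<epsilon>"
    using est randomized_response_ldp[OF A] \<epsilon> by auto
  ultimately show ?thesis
    by (intro INF_lower2[where i = "(est, randomized_response \<epsilon> A)"]) auto
qed

text \<open>Polynomial growth is available only for scale factors at least \<open>1\<close>. For \<open>2 s \<le> 1\<close> the loss is at
  most \<open>L t\<close> by monotonicity, and the constant \<open>exp 1\<close> compensates a small \<open>beta_factor\<close>; \<open>k \<le> 4\<close>
  keeps the geometric factor at least \<open>1\<close>.\<close>

lemma rescaled_loss_gaussian_bound:
  assumes L: "symmetric_loss L" and \<beta>: "0 \<le> \<beta>" and growth: "poly_growth K \<beta> L"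
    and k: "0 < k" "k \<le> 4" and s: "0 \<le> s"
  shows "L (2 * s * t) * exp (- (k * s\<^sup>2))
    \<le> max (exp 1) K * ((2 / sqrt k) powr \<beta> * beta_factor \<beta> * L t)"
proof -
  have Lt: "0 \<le> L t" using L by (auto simp: symmetric_loss_def)
  show ?thesis
  proof (cases "2 * s \<le> 1")
    case True
    have "\<bar>2 * s * t\<bar> \<le> \<bar>t\<bar>"
      using True s by (simp add: abs_mult mult_left_le_one_le)
    then have "L (2 * s * t) \<le> L t" by (rule symmetric_loss_mono[OF L])
    then have "L (2 * s * t) * exp (- (k * s\<^sup>2)) \<le> L t * 1"
      using k L by (intro mult_mono) (auto simp: symmetric_loss_def)
    also have "\<dots> = (exp 1 * (1 * exp (- 1))) * L t"
      by (simp add: exp_minus)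
    also have "\<dots> \<le> (max (exp 1) K * ((2 / sqrt k) powr \<beta> * beta_factor \<beta>)) * L t"
    proof (intro mult_right_mono mult_mono Lt)
      have "sqrt k \<le> 2" using k by (auto intro: real_le_lsqrt)
      then have "1 \<le> 2 / sqrt k" using k by (simp add: le_divide_eq)
      then show "1 \<le> (2 / sqrt k) powr \<beta>" using \<beta> by (rule ge_one_powr_ge_zero)
    qed (use exp_minus_one_le_beta_factor[OF \<beta>] in \<open>auto simp: le_max_iff_disj\<close>)
    finally show ?thesis by (simp add: mult.assoc)
  next
    case False
    have bf: "0 \<le> beta_factor \<beta>"
      using exp_minus_one_le_beta_factor[OF \<beta>] exp_gt_zero[of "-1::real"] by linarith
    have KL: "L t \<le> K * L t"
      using growth unfolding poly_growth_def by (metis mult_1 mult_1_right order_refl powr_one_eq_one)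
    have KL0: "0 \<le> K * L t" using KL Lt by simp
    have "L (2 * s * t) \<le> K * (2 * s) powr \<beta> * L t"
      using growth False unfolding poly_growth_def by auto
    then have "L (2 * s * t) * exp (- (k * s\<^sup>2)) \<le> K * (2 * s) powr \<beta> * L t * exp (- (k * s\<^sup>2))"
      by (intro mult_right_mono) auto
    also have "\<dots> = (K * L t) * ((2 * s) powr \<beta> * exp (- (k * s\<^sup>2)))" by simp
    also have "\<dots> \<le> (K * L t) * ((2 / sqrt k) powr \<beta> * beta_factor \<beta>)"
      using KL0 powr_gaussian_le_beta_factor[OF \<beta> k(1), of s] False by (intro mult_left_mono) auto
    also have "\<dots> \<le> (max (exp 1) K * L t) * ((2 / sqrt k) powr \<beta> * beta_factor \<beta>)"
      using bf Lt by (intro mult_right_mono mult_nonneg_nonneg) auto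
    finally show ?thesis by (simp add: mult_ac)
  qed
qed

theorem corollary6:
  shows "\<exists>(C :: real \<Rightarrow> real) (B :: real). 0 < B \<and>
    (\<forall>(\<mu> :: 'a measure) (\<Theta> :: real set) (p :: real \<Rightarrow> 'a \<Rightarrow> real) (\<theta>0 :: real)
        (score :: 'a \<Rightarrow> real) (\<psi> :: real \<Rightarrow> real) (\<psi>' :: real \<Rightarrow> real).
       \<theta>0 \<in> \<Theta> \<longrightarrow> dominated_family \<mu> \<Theta> p \<longrightarrow>
       L1_differentiable_at \<mu> \<Theta> p \<theta>0 score \<longrightarrow> L1_information \<mu> p \<theta>0 score > 0 \<longrightarrow>
       identifiable_at \<mu> \<Theta> p \<theta>0 \<longrightarrow> C1_near \<Theta> \<theta>0 \<psi> \<psi>' \<longrightarrow> \<psi>' \<theta>0 \<noteq> 0 \<longrightarrow>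
       (\<exists>\<delta>0>0. \<forall>(L :: real \<Rightarrow> real) (C\<^sub>L :: real) (\<beta> :: real) (\<epsilon> :: real) (n :: nat).
          symmetric_loss L \<longrightarrow> 0 \<le> \<beta> \<longrightarrow> poly_growth C\<^sub>L \<beta> L \<longrightarrow> 0 < \<epsilon> \<longrightarrow> \<epsilon> \<le> 2 \<longrightarrow> 1 \<le> n \<longrightarrow>
          ldp_local_minimax_risk n \<mu> \<Theta> (distr_of \<mu> p) \<theta>0 \<psi> L \<epsilon>
          \<le> ennreal (C C\<^sub>L) *
             max (ennreal (B powr \<beta> * beta_factor \<beta> *
                    L (\<psi>' \<theta>0 / L1_information \<mu> p \<theta>0 score * (1 / sqrt (real n * \<epsilon>\<^sup>2)))))
                 (loss_diam L (\<psi> ` \<Theta>) * ennreal (exp (- (\<delta>0\<^sup>2 * real n * \<epsilon>\<^sup>2))))))"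
proof (rule exI[of _ "\<lambda>K. max (exp 1) K"], rule exI[of _ "2 / sqrt (1 / 3200)"],
    intro conjI allI impI)
  (* k = 1 / 3200 is the rate of the Gaussian factor near theta0: Hoeffding contributes 1 / 200 and
     the bound h J / 4 on the total variation distance contributes 1 / 4^2. *)
  show "0 < 2 / sqrt (1 / 3200 :: real)" by simp
next
  fix \<mu> :: "'a measure" and \<Theta> :: "real set" and p :: "real \<Rightarrow> 'a \<Rightarrow> real" and \<theta>0 :: real
    and score :: "'a \<Rightarrow> real" and \<psi> \<psi>' :: "real \<Rightarrow> real"
  assume \<theta>0: "\<theta>0 \<in> \<Theta>" and fam: "dominated_family \<mu> \<Theta> p"
    and dif: "L1_differentiable_at \<mu> \<Theta> p \<theta>0 score" and J: "L1_information \<mu> p \<theta>0 score > 0"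
    and ident: "identifiable_at \<mu> \<Theta> p \<theta>0" and C1: "C1_near \<Theta> \<theta>0 \<psi> \<psi>'" and \<psi>0: "\<psi>' \<theta>0 \<noteq> 0"
  define J where "J = L1_information \<mu> p \<theta>0 score"
  have J0: "J > 0" using J by (simp add: J_def)
  obtain r1 where r1: "r1 > 0" "\<And>\<theta>. \<theta> \<in> \<Theta> \<Longrightarrow> \<theta> \<noteq> \<theta>0 \<Longrightarrow> \<bar>\<theta> - \<theta>0\<bar> < r1 \<Longrightarrow>
      \<bar>\<theta> - \<theta>0\<bar> * J / 2 \<le> (\<integral>x. \<bar>p \<theta> x - p \<theta>0 x\<bar> \<partial>\<mu>)"
    using L1_distance_local_lower_bound[OF fam \<theta>0 dif J] unfolding J_def by metis
  obtain r2 where r2: "r2 > 0" "\<And>\<theta>. \<theta> \<in> \<Theta> \<Longrightarrow> \<bar>\<theta> - \<theta>0\<bar> < r2 \<Longrightarrow>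
      \<bar>\<psi> \<theta> - \<psi> \<theta>0\<bar> \<le> 2 * \<bar>\<psi>' \<theta>0\<bar> * \<bar>\<theta> - \<theta>0\<bar>"
    using C1_near_locally_Lipschitz[OF C1 \<theta>0 \<psi>0] by metis
  define r where "r = min r1 r2 / 2"
  have r: "r > 0" "r < r1" "r < r2" using r1 r2 by (auto simp: r_def)
  obtain \<gamma> where \<gamma>: "\<gamma> > 0" "\<And>\<theta>. \<theta> \<in> \<Theta> \<Longrightarrow> \<bar>\<theta> - \<theta>0\<bar> > r \<Longrightarrow> hellinger_sq \<mu> (p \<theta>) (p \<theta>0) > \<gamma>"
    using ident r(1) unfolding identifiable_at_def by blast
  have pn: "\<forall>x\<in>space \<mu>. 0 \<le> p \<theta> x" and pint: "integrable \<mu> (p \<theta>)" if "\<theta> \<in> \<Theta>" for \<theta>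
    using fam that unfolding dominated_family_def distr_of_def by (auto intro: integrable_prob_density)
  show "\<exists>\<delta>0>0. \<forall>(L :: real \<Rightarrow> real) (C\<^sub>L :: real) (\<beta> :: real) (\<epsilon> :: real) (n :: nat).
          symmetric_loss L \<longrightarrow> 0 \<le> \<beta> \<longrightarrow> poly_growth C\<^sub>L \<beta> L \<longrightarrow> 0 < \<epsilon> \<longrightarrow> \<epsilon> \<le> 2 \<longrightarrow> 1 \<le> n \<longrightarrow>
          ldp_local_minimax_risk n \<mu> \<Theta> (distr_of \<mu> p) \<theta>0 \<psi> L \<epsilon>
          \<le> ennreal (max (exp 1) C\<^sub>L) *
             max (ennreal ((2 / sqrt (1 / 3200)) powr \<beta> * beta_factor \<beta> *
                    L (\<psi>' \<theta>0 / L1_information \<mu> p \<theta>0 score * (1 / sqrt (real n * \<epsilon>\<^sup>2)))))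
                 (loss_diam L (\<psi> ` \<Theta>) * ennreal (exp (- (\<delta>0\<^sup>2 * real n * \<epsilon>\<^sup>2))))"
    (* The two-point bound gives the exponent n eps^2 gamma^2 / 200, and 200 < 15^2. *)
  proof (rule exI[of _ "\<gamma> / 15"], intro conjI allI impI)
    show "0 < \<gamma> / 15" using \<gamma> by simp
  next
    fix L :: "real \<Rightarrow> real" and C\<^sub>L \<beta> \<epsilon> :: real and n :: nat
    assume L: "symmetric_loss L" and \<beta>: "0 \<le> \<beta>" and growth: "poly_growth C\<^sub>L \<beta> L"
      and \<epsilon>: "0 < \<epsilon>" "\<epsilon> \<le> 2" and n: "1 \<le> n"
    define t where "t = \<psi>' \<theta>0 / J * (1 / sqrt (real n * \<epsilon>\<^sup>2))"
    define near where "near = (2 / sqrt (1 / 3200)) powr \<beta> * beta_factor \<beta> * L t"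
    define far where "far = loss_diam L (\<psi> ` \<Theta>) * ennreal (exp (- ((\<gamma> / 15)\<^sup>2 * real n * \<epsilon>\<^sup>2)))"
    let ?V = "\<lambda>\<theta>1. INF (est, Q) \<in> (PiM {..<n} (\<lambda>_. borel) \<rightarrow>\<^sub>M borel) \<times> ldp_channels \<mu> (borel :: real measure) \<epsilon>.
        MAX \<theta>\<in>{\<theta>0, \<theta>1}. private_risk n L Q (distr_of \<mu> p \<theta>) est (\<psi> \<theta>)"
    have "?V \<theta> \<le> ennreal (max (exp 1) C\<^sub>L) * max (ennreal near) far" if \<theta>: "\<theta> \<in> \<Theta>" for \<theta>
    proof (cases "\<bar>\<theta> - \<theta>0\<bar> \<le> r")
      case True
      define h where "h = \<bar>\<theta> - \<theta>0\<bar>"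
      define s where "s = h * J * sqrt (real n * \<epsilon>\<^sup>2)"
      have h0: "0 \<le> h" by (simp add: h_def)
      have nz: "sqrt (real n * \<epsilon>\<^sup>2) > 0" using n \<epsilon> by simp
      have TV: "h * J / 4 \<le> (\<integral>x. \<bar>p \<theta> x - p \<theta>0 x\<bar> \<partial>\<mu>) / 2"
        using r1(2)[OF \<theta>] True r by (cases "\<theta> = \<theta>0") (auto simp: h_def mult.commute)
      have s0: "0 \<le> s" using h0 J0 by (simp add: s_def)
      have "\<bar>\<psi> \<theta> - \<psi> \<theta>0\<bar> \<le> 2 * \<bar>\<psi>' \<theta>0\<bar> * h"
        unfolding h_def using r2(2)[OF \<theta>] True r by auto
      also have "\<dots> = \<bar>2 * s * t\<bar>"
        using nz J0 h0 n \<epsilon> by (simp add: s_def t_def abs_mult)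
      finally have "L (\<psi> \<theta> - \<psi> \<theta>0) \<le> L (2 * s * t)" by (rule symmetric_loss_mono[OF L])
      moreover have "real n * \<epsilon>\<^sup>2 * (h * J / 4)\<^sup>2 / 200 = 1 / 3200 * s\<^sup>2"
        by (simp add: s_def power_mult_distrib power_divide)
      ultimately have "L (\<psi> \<theta> - \<psi> \<theta>0) * exp (- (real n * \<epsilon>\<^sup>2 * (h * J / 4)\<^sup>2 / 200))
          \<le> L (2 * s * t) * exp (- (1 / 3200 * s\<^sup>2))"
        by (simp only: mult_right_mono exp_ge_zero)
      also have "\<dots> \<le> max (exp 1) C\<^sub>L * near"
        unfolding near_def by (rule rescaled_loss_gaussian_bound[OF L \<beta> growth]) (use s0 in auto)
      finally have *: "L (\<psi> \<theta> - \<psi> \<theta>0) * exp (- (real n * \<epsilon>\<^sup>2 * (h * J / 4)\<^sup>2 / 200))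
          \<le> max (exp 1) C\<^sub>L * near" .
      have "?V \<theta> \<le> ennreal (L (\<psi> \<theta> - \<psi> \<theta>0)) * ennreal (exp (- (real n * \<epsilon>\<^sup>2 * (h * J / 4)\<^sup>2 / 200)))"
        using h0 J0 TV by (intro ldp_two_point_bound[OF fam \<theta>0 \<theta> L \<epsilon> n]) auto
      also have "\<dots> = ennreal (L (\<psi> \<theta> - \<psi> \<theta>0) * exp (- (real n * \<epsilon>\<^sup>2 * (h * J / 4)\<^sup>2 / 200)))"
        using L by (subst ennreal_mult) (auto simp: symmetric_loss_def)
      also have "\<dots> \<le> ennreal (max (exp 1) C\<^sub>L * near)"
        using * by (rule ennreal_leI)
      also have "\<dots> = ennreal (max (exp 1) C\<^sub>L) * ennreal near"
        by (rule ennreal_mult') (auto simp: le_max_iff_disj)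
      also have "\<dots> \<le> ennreal (max (exp 1) C\<^sub>L) * max (ennreal near) far"
        by (intro mult_left_mono) auto
      finally show ?thesis .
    next
      case False
      have "\<gamma> < hellinger_sq \<mu> (p \<theta>) (p \<theta>0)" using \<gamma>(2)[OF \<theta>] False by auto
      also have "\<dots> \<le> (\<integral>x. \<bar>p \<theta> x - p \<theta>0 x\<bar> \<partial>\<mu>) / 2"
        using \<theta> \<theta>0 pn pint by (intro hellinger_sq_le_half_L1) auto
      finally have TV: "\<gamma> \<le> (\<integral>x. \<bar>p \<theta> x - p \<theta>0 x\<bar> \<partial>\<mu>) / 2" by simp
      have "?V \<theta> \<le> ennreal (L (\<psi> \<theta> - \<psi> \<theta>0)) * ennreal (exp (- (real n * \<epsilon>\<^sup>2 * \<gamma>\<^sup>2 / 200)))"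
        using \<gamma> TV by (intro ldp_two_point_bound[OF fam \<theta>0 \<theta> L \<epsilon> n]) auto
      also have "\<dots> \<le> far"
        unfolding far_def
      proof (intro mult_mono ennreal_leI loss_le_loss_diam[OF L])
        have "0 \<le> real n * \<epsilon>\<^sup>2 * \<gamma>\<^sup>2" by simp
        then show "exp (- (real n * \<epsilon>\<^sup>2 * \<gamma>\<^sup>2 / 200)) \<le> exp (- ((\<gamma> / 15)\<^sup>2 * real n * \<epsilon>\<^sup>2))"
          by (simp add: power_divide field_simps)
      qed (use \<theta> \<theta>0 in auto)
      also have "\<dots> \<le> 1 * max (ennreal near) far" by simp
      also have "\<dots> \<le> ennreal (max (exp 1) C\<^sub>L) * max (ennreal near) far"
        by (intro mult_right_mono) (auto simp: le_max_iff_disj)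
      finally show ?thesis .
    qed
    then show "ldp_local_minimax_risk n \<mu> \<Theta> (distr_of \<mu> p) \<theta>0 \<psi> L \<epsilon>
          \<le> ennreal (max (exp 1) C\<^sub>L) *
             max (ennreal ((2 / sqrt (1 / 3200)) powr \<beta> * beta_factor \<beta> *
                    L (\<psi>' \<theta>0 / L1_information \<mu> p \<theta>0 score * (1 / sqrt (real n * \<epsilon>\<^sup>2)))))
                 (loss_diam L (\<psi> ` \<Theta>) * ennreal (exp (- ((\<gamma> / 15)\<^sup>2 * real n * \<epsilon>\<^sup>2))))"
      unfolding ldp_local_minimax_risk_def local_minimax_risk_def
        near_def far_def t_def J_def
      by (intro SUP_least)
  qed
qed

end
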